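(* Let $m\ge 2$ be an integer and let $\mathcal A$ be an alphabet of $m$ letters. Let $p$ be a pattern that uses exactly $r\ge 1$ distinct variables, where the $j$th variable occurs $k_j\ge 1$ times in $p$, and where the variables are indexed so that $1=k_1=\cdots=k_s<k_{s+1}\le\cdots\le k_r$ (with $0\le s\le r$). Let $\widehat{\Omega}_n$ denote the mean number of occurrences of $p$ in a full word of length $n$ over $\mathcal A$. Then, as $n\to\infty$ with $p$ and $m$ fixed, $$\widehat{\Omega}_n\sim\frac{1}{\prod_{j=s+1}^r(m^{k_j-1}-1)}\,\frac{n^{s+1}}{(s+1)!}.$$
   Context: A (full) word over $\mathcal A$ is a finite sequence of letters of $\mathcal A$; a pattern is a nonempty word $p$ over an alphabet $\mathcal V$ of variables, and $\mathcal V$ is taken to be the set of variables appearing in $p$. A morphism $h:\mathcal V^*\to\mathcal A^*$ is nonerasing if $h(v)$ is nonempty for every $v\in\mathcal V$. Counting occurrences: the number of occurrences of $p$ in a word $w$ is the sum, over all distinct nonerasing morphisms $h:\mathcal V^*\to\mathcal A^*$, of the number of positions at which $h(p)$ occurs as a factor (contiguous block) of $w$. (For example, the word $11111111$ contains $34$ occurrences of $aba$.) The mean is taken over all $m^n$ words of length $n$ over $\mathcal A$, uniformly. The notation $\sim$ means that the ratio of the two sides tends to $1$. Empty products equal $1$. *)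

theory Defs
  imports "HOL-Analysis.Infinite_Sum" "HOL-Library.FuncSet" "HOL-Library.Landau_Symbols"
begin

text \<open>
  Morphisms between the free monoids \<open>lists V\<close> and \<open>lists A\<close>.  Extensionality outside \<open>lists V\<close>
  makes equality in HOL coincide with equality as maps on \<open>lists V\<close>, so that distinct morphisms
  are counted once.
\<close>

definition nonerasing_morphisms :: "'v set \<Rightarrow> 'a set \<Rightarrow> ('v list \<Rightarrow> 'a list) set" where
  "nonerasing_morphisms V A =
     {h \<in> lists V \<rightarrow>\<^sub>E lists A.
        h [] = [] \<and>
        (\<forall>u\<in>lists V. \<forall>v\<in>lists V. h (u @ v) = h u @ h v) \<and>
        (\<forall>x\<in>V. h [x] \<noteq> [])}"

definition factor_positions :: "'a list \<Rightarrow> 'a list \<Rightarrow> nat set" where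
  "factor_positions u w = {i. \<exists>x y. w = x @ u @ y \<and> length x = i}"

text \<open>
  The index set of the sum is infinite, but only finitely many terms are nonzero
  (\<open>finite_occurring_morphisms\<close> below), so this is in effect a finite sum.
\<close>

definition occurrences :: "'a set \<Rightarrow> 'v list \<Rightarrow> 'a list \<Rightarrow> nat" where
  "occurrences A p w =
     (\<Sum>\<^sub>\<infinity>h\<in>nonerasing_morphisms (set p) A. card (factor_positions (h p) w))"

definition words :: "'a set \<Rightarrow> nat \<Rightarrow> 'a list set" where
  "words A n = {w \<in> lists A. length w = n}"

definition mean_occurrences :: "'a set \<Rightarrow> 'v list \<Rightarrow> nat \<Rightarrow> real" where
  "mean_occurrences A p n =
     (\<Sum>w\<in>words A n. real (occurrences A p w)) / real (card (words A n))"

lemma morphism_eq_concat: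
  assumes "h \<in> nonerasing_morphisms V A" "u \<in> lists V"
  shows "h u = concat (map (\<lambda>x. h [x]) u)"
  using assms(2)
proof (induction u)
  case Nil
  have "h [] = []"
    using assms(1) unfolding nonerasing_morphisms_def by blast
  then show ?case by simp
next
  case (Cons x u)
  have "h (v @ w) = h v @ h w" if "v \<in> lists V" "w \<in> lists V" for v w
    using assms(1) that unfolding nonerasing_morphisms_def by fast
  from this[of "[x]" u] have "h ([x] @ u) = h [x] @ h u"
    using Cons.hyps by simp
  also have "h u = concat (map (\<lambda>x. h [x]) u)"
    by (rule Cons.IH)
  finally show ?case by simp
qed

lemma nonerasing_morphism_PiE:
  "h \<in> nonerasing_morphisms V A \<Longrightarrow> h \<in> lists V \<rightarrow>\<^sub>E lists A"
  unfolding nonerasing_morphisms_def by blast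

lemma finite_factor_positions: "finite (factor_positions u w)"
  by (rule finite_subset[of _ "{..length w}"]) (auto simp: factor_positions_def)

lemma finite_occurring_morphisms:
  assumes "finite A"
  shows "finite {h \<in> nonerasing_morphisms (set p) A. factor_positions (h p) w \<noteq> {}}"
    (is "finite ?M")
proof -
  let ?f = "\<lambda>h. \<lambda>x\<in>set p. h [x]"
  have "?f ` ?M \<subseteq> set p \<rightarrow>\<^sub>E {u. set u \<subseteq> A \<and> length u \<le> length w}"
  proof (clarify, intro PiE_I)
    fix h x
    assume h: "h \<in> nonerasing_morphisms (set p) A" and x: "x \<in> set p"
      and ne: "factor_positions (h p) w \<noteq> {}"
    have "h p = concat (map (\<lambda>x. h [x]) p)"
      using h by (intro morphism_eq_concat) auto
    moreover obtain ys zs where "p = ys @ x # zs"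
      using split_list[OF x] by blast
    then have "length (h [x]) \<le> length (concat (map (\<lambda>x. h [x]) p))" by simp
    ultimately have "length (h [x]) \<le> length (h p)" by metis
    also have "\<dots> \<le> length w" using ne by (auto simp: factor_positions_def)
    finally have "length (h [x]) \<le> length w" .
    moreover have "h [x] \<in> lists A"
      using x by (intro PiE_mem[OF nonerasing_morphism_PiE[OF h]]) auto
    ultimately show "?f h x \<in> {u. set u \<subseteq> A \<and> length u \<le> length w}"
      using x by auto
  qed auto
  then have "finite (?f ` ?M)"
    by (rule finite_subset) (intro finite_PiE finite_lists_length_le finite_set assms)
  moreover have "inj_on ?f ?M"
  proof (rule inj_onI)
    fix g h assume g: "g \<in> ?M" and h: "h \<in> ?M" and eq: "?f g = ?f h"
    have eq': "g [x] = h [x]" if "x \<in> set p" for x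
      using fun_cong[OF eq, of x] that by simp
    show "g = h"
    proof (rule PiE_ext)
      show "g \<in> lists (set p) \<rightarrow>\<^sub>E lists A" "h \<in> lists (set p) \<rightarrow>\<^sub>E lists A"
        using g h nonerasing_morphism_PiE by blast+
      fix u assume u: "u \<in> lists (set p)"
      have "g u = concat (map (\<lambda>x. g [x]) u)"
        using g u by (intro morphism_eq_concat) auto
      also have "map (\<lambda>x. g [x]) u = map (\<lambda>x. h [x]) u"
        using u eq' by (intro map_cong) auto
      also have "concat \<dots> = h u"
        using h u by (intro morphism_eq_concat[symmetric]) auto
      finally show "g u = h u" .
    qed
  qed
  ultimately show ?thesis by (rule finite_imageD)
qed

lemma occurrences_eq_finite_sum:
  assumes "finite A"
  shows "occurrences A p w =
    (\<Sum>h | h \<in> nonerasing_morphisms (set p) A \<and> factor_positions (h p) w \<noteq> {}.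
       card (factor_positions (h p) w))"
proof -
  have "occurrences A p w =
    (\<Sum>\<^sub>\<infinity>h\<in>{h \<in> nonerasing_morphisms (set p) A. factor_positions (h p) w \<noteq> {}}.
       card (factor_positions (h p) w))"
    unfolding occurrences_def by (rule infsum_cong_neutral) auto
  also have "\<dots> = (\<Sum>h | h \<in> nonerasing_morphisms (set p) A \<and> factor_positions (h p) w \<noteq> {}.
       card (factor_positions (h p) w))"
    by (rule infsum_finite[OF finite_occurring_morphisms[OF assms]])
  finally show ?thesis .
qed

end

theory Submission
  imports Defs "HOL-Analysis.Uniform_Limit"
begin

text \<open>
  A word of length \<open>L\<close> occurs on average \<open>(n + 1 - L) / m ^ L\<close> times in a word of length \<open>n\<close>, so the
  mean is the sum of this over all substitutions.  Summing out the image of one variable \<open>v\<close> at a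
  time, where there are \<open>m ^ j\<close> choices of length \<open>j\<close>, turns the sum \<open>F\<close> over the other variables into
  \<open>\<Sum>j\<ge>1. (1 / m ^ (k v - 1)) ^ j * F (t - k v * j)\<close> with \<open>t = n + 1\<close>.  If \<open>k v = 1\<close> this is a sum of
  consecutive values and raises the degree of growth \<open>d\<close> by one, dividing the constant by \<open>d + 1\<close>.
  If \<open>k v > 1\<close> it is a convolution with a geometric series, which by dominated convergence keeps the
  degree and divides the constant by \<open>m ^ (k v - 1) - 1\<close>.
\<close>

section \<open>Growth of partial sums and geometric convolutions\<close>

text \<open>Past some \<open>N\<close> the increments of \<open>a n - L * b n\<close> are at most
  \<open>e / 2\<close> times those of \<open>b\<close>. Telescoping bounds the total drift from
  \<open>N\<close> by \<open>e / 2 * (b n - b N)\<close>, and the fixed value at \<open>N\<close> is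
  negligible because \<open>b\<close> is unbounded.\<close>

lemma stolz_cesaro:
  fixes a b :: "nat \<Rightarrow> real"
  assumes mono: "\<And>n. b n < b (Suc n)"
    and b: "filterlim b at_top sequentially"
    and lim: "(\<lambda>n. (a (Suc n) - a n) / (b (Suc n) - b n)) \<longlonglongrightarrow> L"
  shows "(\<lambda>n. a n / b n) \<longlonglongrightarrow> L"
proof (rule tendstoI)
  fix e :: real assume e: "e > 0"
  let ?c = "\<lambda>n. a n - L * b n"
  have ev: "eventually (\<lambda>n. dist ((a (Suc n) - a n) / (b (Suc n) - b n)) L < e / 2) sequentially"
    using lim e by (intro tendstoD) auto
  have "eventually (\<lambda>n. b n > 0) sequentially"
    using b by (auto simp: filterlim_at_top_dense)
  with ev obtain N where N: "\<And>n. n \<ge> N \<Longrightarrow> dist ((a (Suc n) - a n) / (b (Suc n) - b n)) L < e / 2"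
    and bN: "\<And>n. n \<ge> N \<Longrightarrow> b n > 0"
    using eventually_conj[OF ev \<open>eventually (\<lambda>n. b n > 0) sequentially\<close>]
    unfolding eventually_sequentially by blast
  have step: "\<bar>?c (Suc n) - ?c n\<bar> \<le> e / 2 * (b (Suc n) - b n)" if "n \<ge> N" for n
  proof -
    have pos: "b (Suc n) - b n > 0" using mono[of n] by simp
    have "?c (Suc n) - ?c n = ((a (Suc n) - a n) / (b (Suc n) - b n) - L) * (b (Suc n) - b n)"
      using pos by (simp add: field_simps)
    also have "\<bar>\<dots>\<bar> = \<bar>(a (Suc n) - a n) / (b (Suc n) - b n) - L\<bar> * (b (Suc n) - b n)"
      using pos by (simp add: abs_mult)
    also have "\<dots> \<le> e / 2 * (b (Suc n) - b n)"
      using N[OF that] pos by (intro mult_right_mono) (auto simp: dist_real_def)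
    finally show ?thesis .
  qed
  have tele: "\<bar>?c n - ?c N\<bar> \<le> e / 2 * (b n - b N)" if "n \<ge> N" for n
    using that
  proof (induction n rule: dec_induct)
    case (step n)
    then have "\<bar>?c (Suc n) - ?c N\<bar> \<le> e / 2 * (b n - b N) + e / 2 * (b (Suc n) - b n)"
      using \<open>n \<ge> N \<Longrightarrow> \<bar>?c (Suc n) - ?c n\<bar> \<le> e / 2 * (b (Suc n) - b n)\<close> by linarith
    then show ?case unfolding right_diff_distrib by linarith
  qed simp
  \<comment> \<open>This threshold makes the starting value \<open>\<bar>?c N\<bar>\<close> cost
    less than \<open>e / 2 * b n\<close>, the other half of the allowance.\<close>
  have "eventually (\<lambda>n. b n > 2 * \<bar>?c N\<bar> / e) sequentially"
    using b by (auto simp: filterlim_at_top_dense)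
  then show "eventually (\<lambda>n. dist (a n / b n) L < e) sequentially"
    using eventually_ge_at_top[of N]
  proof eventually_elim
    case (elim n)
    have pos: "b n > 0" using bN elim by simp
    have "\<bar>?c n\<bar> \<le> \<bar>?c N\<bar> + e / 2 * (b n - b N)"
      using tele[OF elim(2)] by linarith
    also have "\<dots> < e / 2 * b n + e / 2 * b n"
    proof (rule add_less_le_mono)
      show "\<bar>?c N\<bar> < e / 2 * b n" using elim(1) e by (simp add: field_simps)
      show "e / 2 * (b n - b N) \<le> e / 2 * b n" using bN[of N] e by (intro mult_left_mono) auto
    qed
    finally have "\<bar>?c n\<bar> < e * b n" by (simp add: field_simps)
    moreover have "a n / b n - L = ?c n / b n" using pos by (simp add: field_simps)
    ultimately show ?case using pos by (simp add: dist_real_def field_simps)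
  qed
qed

text \<open>Stolz-Cesaro against \<open>n ^ (d + 1)\<close>: the increment of the partial sums is
  \<open>f n\<close>, and the increment of the power is \<open>n ^ d\<close> times a sum of
  \<open>d + 1\<close> terms that each tend to 1.\<close>

lemma partial_sums_power_asymptotics:
  fixes f :: "nat \<Rightarrow> real"
  assumes f: "(\<lambda>n. f n / real n ^ d) \<longlonglongrightarrow> C"
  shows "(\<lambda>n. (\<Sum>i<n. f i) / real n ^ Suc d) \<longlonglongrightarrow> C / real (Suc d)"
proof (rule stolz_cesaro)
  show "real n ^ Suc d < real (Suc n) ^ Suc d" for n
    by (intro power_strict_mono) auto
  show "filterlim (\<lambda>n. real n ^ Suc d) at_top sequentially"
    by (intro filterlim_pow_at_top filterlim_real_sequentially) auto
  have diff: "(real (Suc n) ^ Suc d - real n ^ Suc d) / real n ^ d = (\<Sum>i\<le>d. (1 + 1 / real n) ^ i)"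
    if "n > 0" for n
  proof -
    have "real (Suc n) ^ Suc d - real n ^ Suc d = (\<Sum>i<Suc d. real n ^ (d - i) * real (Suc n) ^ i)"
      using power_diff_sumr2[of "real (Suc n)" "Suc d" "real n"] by simp
    also have "\<dots> = (\<Sum>i\<le>d. real n ^ d * (1 + 1 / real n) ^ i)"
    proof (intro sum.cong)
      fix i assume "i \<in> {..d}"
      then have "real n ^ d = real n ^ (d - i) * real n ^ i" by (simp flip: power_add)
      moreover have "real (Suc n) = real n * (1 + 1 / real n)" using that by (simp add: field_simps)
      ultimately show "real n ^ (d - i) * real (Suc n) ^ i = real n ^ d * (1 + 1 / real n) ^ i"
        by (metis power_mult_distrib mult.assoc)
    qed (simp add: lessThan_Suc_atMost)
    finally show ?thesis using that by (simp flip: sum_distrib_left)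
  qed
  have "(\<lambda>n. 1 + 1 / real n) \<longlonglongrightarrow> 1 + 0"
    by (intro tendsto_intros lim_1_over_n)
  then have "(\<lambda>n. \<Sum>i\<le>d. (1 + 1 / real n) ^ i) \<longlonglongrightarrow> (\<Sum>i\<le>d. (1 + 0) ^ i)"
    by (intro tendsto_intros)
  then have "(\<lambda>n. (f n / real n ^ d) / (\<Sum>i\<le>d. (1 + 1 / real n) ^ i)) \<longlonglongrightarrow> C / real (Suc d)"
    by (intro tendsto_divide f) auto
  moreover have "eventually (\<lambda>n. (f n / real n ^ d) / (\<Sum>i\<le>d. (1 + 1 / real n) ^ i) =
      ((\<Sum>i<Suc n. f i) - (\<Sum>i<n. f i)) / (real (Suc n) ^ Suc d - real n ^ Suc d)) sequentially"
    using eventually_gt_at_top[of 0]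
  proof eventually_elim
    case (elim n)
    then show ?case unfolding diff[OF elim, symmetric] by simp
  qed
  ultimately show "(\<lambda>n. ((\<Sum>i<Suc n. f i) - (\<Sum>i<n. f i)) /
      (real (Suc n) ^ Suc d - real n ^ Suc d)) \<longlonglongrightarrow> C / real (Suc d)"
    by (rule Lim_transform_eventually)
qed

text \<open>A fixed shift \<open>k * j\<close> does not affect the leading power, so the
  \<open>j\<close>th normalised term tends to \<open>x ^ j * C\<close>. These terms are dominated by
  \<open>B * x ^ j\<close>, so Tannery's theorem allows summing the limits, and the geometric series
  from \<open>j = 1\<close> is \<open>x / (1 - x)\<close>.\<close>

lemma geometric_convolution_power_asymptotics:
  fixes f :: "nat \<Rightarrow> real"
  assumes f: "(\<lambda>n. f n / real n ^ d) \<longlonglongrightarrow> C" and f0: "f 0 = 0"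
    and x: "0 < x" "x < 1" and k: "k \<ge> 1"
  shows "(\<lambda>n. (\<Sum>j=1..n. x ^ j * f (n - k * j)) / real n ^ d) \<longlonglongrightarrow> C * (x / (1 - x))"
proof -
  obtain B where B: "\<And>n. \<bar>f n / real n ^ d\<bar> \<le> B"
    using convergent_imp_Bseq[OF convergentI[OF f]] unfolding Bseq_def by auto
  have "B \<ge> 0" using B[of 0] by linarith
  \<comment> \<open>At \<open>n = 0\<close> with \<open>d > 0\<close> the quotient is 0 by
    convention and says nothing about \<open>f 0\<close>; there \<open>f 0 = 0\<close> gives the
    bound.\<close>
  have fB: "\<bar>f n\<bar> \<le> B * real n ^ d" for n
  proof (cases "n = 0")
    case False
    then show ?thesis using B[of n] by (simp add: field_simps)
  qed (use f0 \<open>B \<ge> 0\<close> in simp)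
  \<comment> \<open>The index is shifted by one because \<open>suminf\<close> starts at 0 and the
    convolution at 1.\<close>
  let ?a = "\<lambda>j n. x ^ Suc j * f (n - k * Suc j) / real n ^ d"
  have lim: "(\<lambda>n. ?a j n) \<longlonglongrightarrow> x ^ Suc j * C" for j
  proof -
    let ?q = "k * Suc j"
    \<comment> \<open>The extra factor is \<open>(n / (n + ?q)) ^ d\<close>, which replaces
      \<open>n ^ d\<close> by \<open>(n + ?q) ^ d\<close>. With the shift on the denominator no
      truncated subtraction arises until \<open>LIMSEQ_offset\<close>.\<close>
    have "(\<lambda>n. f n / real n ^ d * (1 - real ?q / real (n + ?q)) ^ d) \<longlonglongrightarrow> C * (1 - 0) ^ d"
      by (intro tendsto_intros f LIMSEQ_ignore_initial_segment[OF lim_const_over_n])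
    moreover have "eventually (\<lambda>n. f n / real n ^ d * (1 - real ?q / real (n + ?q)) ^ d
        = f n / real (n + ?q) ^ d) sequentially"
      using eventually_gt_at_top[of 0]
    proof eventually_elim
      case (elim n)
      then have "1 - real ?q / real (n + ?q) = real n / real (n + ?q)" 
        by (simp add: divide_simps del: mult_Suc_right of_nat_mult)
      then show ?case using elim by (simp only: power_divide) simp
    qed
    ultimately have "(\<lambda>n. f n / real (n + ?q) ^ d) \<longlonglongrightarrow> C"
      by (subst (asm) filterlim_cong[OF refl refl]) (assumption, simp)
    then have "(\<lambda>n. f (n + ?q - ?q) / real (n + ?q) ^ d) \<longlonglongrightarrow> C"
      by simp
    then have "(\<lambda>n. f (n - ?q) / real n ^ d) \<longlonglongrightarrow> C"
      by (rule LIMSEQ_offset)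
    then have "(\<lambda>n. x ^ Suc j * (f (n - ?q) / real n ^ d)) \<longlonglongrightarrow> x ^ Suc j * C"
      by (intro tendsto_intros)
    then show ?thesis by simp
  qed
  have bound: "\<bar>?a j n\<bar> \<le> B * x ^ Suc j" for j n
  proof -
    have "\<bar>f (n - k * Suc j)\<bar> \<le> B * real n ^ d"
      by (rule order_trans[OF fB], intro mult_left_mono power_mono) (auto simp: \<open>B \<ge> 0\<close>)
    then have "\<bar>f (n - k * Suc j)\<bar> / real n ^ d \<le> B"
      using \<open>B \<ge> 0\<close> by (cases "real n ^ d = 0") (auto simp: field_simps)
    then have "x ^ Suc j * (\<bar>f (n - k * Suc j)\<bar> / real n ^ d) \<le> x ^ Suc j * B"
      using x by (intro mult_left_mono) auto
    then show ?thesis using x by (simp add: abs_mult mult_ac)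
  qed
  have geom: "(\<lambda>j. x ^ Suc j) sums (x / (1 - x))"
    using sums_mult[OF geometric_sums[of x], of x] x by simp
  have "(\<lambda>n. suminf (\<lambda>j. ?a j n)) \<longlonglongrightarrow> suminf (\<lambda>j. x ^ Suc j * C)"
  proof (rule tannerys_theorem[THEN conjunct2, THEN conjunct2])
    show "eventually (\<lambda>(j, n). norm (?a j n) \<le> B * x ^ Suc j) (sequentially \<times>\<^sub>F sequentially)"
      using bound by (intro always_eventually) auto
    show "summable (\<lambda>j. B * x ^ Suc j)"
      using geom by (intro summable_mult sums_summable)
  qed (use lim in auto)
  also have "suminf (\<lambda>j. x ^ Suc j * C) = C * (x / (1 - x))"
    using sums_unique[OF sums_mult[OF geom, of C]] by (simp add: mult.commute)
  also have "(\<lambda>n. suminf (\<lambda>j. ?a j n)) = (\<lambda>n. (\<Sum>j=1..n. x ^ j * f (n - k * j)) / real n ^ d)"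
  proof
    fix n
    \<comment> \<open>For \<open>j \<ge> n\<close> the argument of \<open>f\<close> truncates to 0,
      where \<open>f\<close> vanishes.\<close>
    have "suminf (\<lambda>j. ?a j n) = (\<Sum>j<n. ?a j n)"
    proof (rule suminf_finite)
      fix j assume "j \<notin> {..<n}"
      then have "n \<le> 1 * Suc j" by simp
      also have "\<dots> \<le> k * Suc j" using k by (intro mult_right_mono) auto
      finally show "?a j n = 0" using f0 by simp
    qed simp
    also have "\<dots> = (\<Sum>j=1..n. x ^ j * f (n - k * j)) / real n ^ d"
      unfolding sum_divide_distrib
      by (rule sum.reindex_bij_witness[of _ "\<lambda>j. j - 1" Suc]) auto
    finally show "suminf (\<lambda>j. ?a j n) = (\<Sum>j=1..n. x ^ j * f (n - k * j)) / real n ^ d" .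
  qed
  finally show ?thesis .
qed

section \<open>The weighted sum over substitutions\<close>

text \<open>The cutoff \<open>N\<close> keeps the set of substitutions finite; longer images cannot
  occur in words of length at most \<open>N\<close>.\<close>

definition bounded_words :: "'a set \<Rightarrow> nat \<Rightarrow> 'a list set" where
  "bounded_words A N = {u \<in> lists A. u \<noteq> [] \<and> length u \<le> N}"

text \<open>For \<open>K = count_list p\<close> and \<open>V = set p\<close> this is the length of
  the image of \<open>p\<close>. The multiplicities are kept separate from any pattern so that an
  induction can vary \<open>V\<close> alone.\<close>

definition image_length :: "('v \<Rightarrow> nat) \<Rightarrow> 'v set \<Rightarrow> ('v \<Rightarrow> 'a list) \<Rightarrow> nat" where
  "image_length K V \<phi> = (\<Sum>v\<in>V. K v * length (\<phi> v))"

text \<open>Truncated subtraction discards the substitutions whose image is longer than \<open>t - 1\<close>.\<close>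

definition subst_sum :: "'a set \<Rightarrow> ('v \<Rightarrow> nat) \<Rightarrow> 'v set \<Rightarrow> nat \<Rightarrow> nat \<Rightarrow> real" where
  "subst_sum A K V N t =
     (\<Sum>\<phi>\<in>V \<rightarrow>\<^sub>E bounded_words A N.
        real (t - image_length K V \<phi>) / real (card A) ^ image_length K V \<phi>)"

lemma card_words: "finite A \<Longrightarrow> card (words A n) = card A ^ n"
  using card_lists_length_eq[of A n] by (simp add: words_def lists_eq_set)

lemma finite_words: "finite A \<Longrightarrow> finite (words A n)"
  using finite_lists_length_eq[of A n] by (simp add: words_def lists_eq_set)

lemma finite_bounded_words: "finite A \<Longrightarrow> finite (bounded_words A N)"
  by (rule finite_subset[OF _ finite_lists_length_le[of A N]]) (auto simp: bounded_words_def)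

lemma sum_bounded_words_length:
  fixes f :: "nat \<Rightarrow> real"
  assumes "finite A"
  shows "(\<Sum>u\<in>bounded_words A N. f (length u)) = (\<Sum>j=1..N. real (card A) ^ j * f j)"
proof -
  have "(\<Sum>u\<in>bounded_words A N. f (length u))
      = (\<Sum>j=1..N. \<Sum>u | u \<in> bounded_words A N \<and> length u = j. f (length u))"
    using finite_bounded_words[OF assms]
    by (intro sum.group[symmetric]) (auto simp: bounded_words_def Suc_le_eq)
  also have "\<dots> = (\<Sum>j=1..N. \<Sum>u\<in>words A j. f j)"
    by (intro sum.cong) (auto simp: bounded_words_def words_def)
  finally show ?thesis using assms by (simp add: card_words)
qed

text \<open>An image of \<open>v\<close> of length \<open>j\<close> adds \<open>K v * j\<close> to
  the total length, contributing the weight \<open>1 / m ^ (K v * j)\<close>. The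
  \<open>m ^ j\<close> words of that length turn this weight into a geometric one of ratio
  \<open>1 / m ^ (K v - 1)\<close>.\<close>

lemma subst_sum_insert:
  assumes A: "finite A" and V: "finite V" "v \<notin> V" and K: "K v \<ge> 1" and "card A \<ge> 1"
  shows "subst_sum A K (insert v V) N t =
    (\<Sum>j=1..N. (1 / real (card A) ^ (K v - 1)) ^ j * subst_sum A K V N (t - K v * j))"
proof -
  let ?m = "real (card A)" and ?W = "bounded_words A N" and ?L = "image_length K V"
  have L: "image_length K (insert v V) (\<phi>(v := u)) = K v * length u + ?L \<phi>"
    for \<phi> and u :: "'a list"
  proof -
    have "(\<Sum>w\<in>V. K w * length ((\<phi>(v := u)) w)) = (\<Sum>w\<in>V. K w * length (\<phi> w))"
      using V by (intro sum.cong) auto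
    then show ?thesis using V by (simp add: image_length_def)
  qed
  have "subst_sum A K (insert v V) N t =
     (\<Sum>(u, \<phi>)\<in>?W \<times> (V \<rightarrow>\<^sub>E ?W).
        real (t - (K v * length u + ?L \<phi>)) / ?m ^ (K v * length u + ?L \<phi>))"
    unfolding subst_sum_def PiE_insert_eq
    by (subst sum.reindex[OF inj_combinator[OF V(2)]]) (simp add: L case_prod_unfold)
  \<comment> \<open>Truncated subtraction still satisfies \<open>t - (a + b) = t - a - b\<close>, so
    the inner sum is \<open>subst_sum\<close> at a smaller argument.\<close>
  also have "\<dots> = (\<Sum>u\<in>?W. 1 / ?m ^ (K v * length u) * subst_sum A K V N (t - K v * length u))"
    unfolding sum.cartesian_product[symmetric] subst_sum_def sum_distrib_left
    by (simp add: power_add)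
  also have "\<dots> = (\<Sum>j=1..N. ?m ^ j * (1 / ?m ^ (K v * j) * subst_sum A K V N (t - K v * j)))"
    by (rule sum_bounded_words_length[OF A])
  also have "\<dots> = (\<Sum>j=1..N. (1 / ?m ^ (K v - 1)) ^ j * subst_sum A K V N (t - K v * j))"
  proof (intro sum.cong refl)
    fix j
    have "K v * j = (K v - 1) * j + j" using K by (cases "K v") auto
    then have "?m ^ j * (1 / ?m ^ (K v * j)) = (1 / ?m ^ (K v - 1)) ^ j"
      using assms(5) by (simp add: power_add power_mult power_divide)
    then show "?m ^ j * (1 / ?m ^ (K v * j) * subst_sum A K V N (t - K v * j)) =
        (1 / ?m ^ (K v - 1)) ^ j * subst_sum A K V N (t - K v * j)"
      by (metis mult.assoc)
  qed
  finally show ?thesis .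
qed

lemma subst_sum_zero [simp]: "subst_sum A K V N 0 = 0"
  by (simp add: subst_sum_def)

text \<open>Induction on \<open>V\<close>, summing out one variable per step. The function
  \<open>F\<close> frees the sum from the cutoff, which stops mattering once
  \<open>t \<le> N\<close>, so that \<open>t\<close> alone can tend to infinity.\<close>

lemma subst_sum_asymptotics:
  fixes K :: "'v \<Rightarrow> nat" and A :: "'a set"
  assumes "finite V" and A: "finite A" "card A \<ge> 2" and "\<And>v. v \<in> V \<Longrightarrow> K v \<ge> 1"
  shows "\<exists>F. (\<forall>N t. t \<le> N \<longrightarrow> subst_sum A K V N t = F t) \<and>
     (\<lambda>t. F t / real t ^ Suc (card {v\<in>V. K v = 1})) \<longlonglongrightarrow>
       1 / (\<Prod>v\<in>{v\<in>V. K v > 1}. real (card A) ^ (K v - 1) - 1) / fact (Suc (card {v\<in>V. K v = 1}))"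
  using assms(1,4)
proof (induction V)
  case empty
  have "eventually (\<lambda>t. real t / real t ^ Suc 0 = 1) sequentially"
    using eventually_gt_at_top[of 0] by eventually_elim simp
  then have "(\<lambda>t. real t / real t ^ Suc 0) \<longlonglongrightarrow> 1"
    by (rule tendsto_eventually)
  then show ?case
    \<comment> \<open>The only substitution is the empty one, of image length 0, so the sum is
      \<open>t\<close> itself.\<close>
    by (intro exI[of _ real]) (auto simp: subst_sum_def image_length_def)
next
  case (insert v V)
  let ?m = "real (card A)"
  let ?d = "Suc (card {v\<in>V. K v = 1})"
  let ?C = "1 / (\<Prod>v\<in>{v\<in>V. K v > 1}. ?m ^ (K v - 1) - 1) / fact ?d"
  obtain F where F: "\<And>N t. t \<le> N \<Longrightarrow> subst_sum A K V N t = F t"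
    and lim: "(\<lambda>t. F t / real t ^ ?d) \<longlonglongrightarrow> ?C"
    using insert.IH insert.prems by auto
  have F0: "F 0 = 0" using F[of 0 0] by simp
  have Kv: "K v \<ge> 1" using insert.prems by simp
  let ?x = "1 / ?m ^ (K v - 1)"
  \<comment> \<open>The sum may stop at \<open>t\<close> instead of \<open>N\<close>: for
    \<open>j > t\<close> the argument truncates to 0 and \<open>F 0 = 0\<close>.\<close>
  define F' where "F' = (\<lambda>t. \<Sum>j=1..t. ?x ^ j * F (t - K v * j))"
  have F': "subst_sum A K (insert v V) N t = F' t" if "t \<le> N" for N t
  proof -
    have "subst_sum A K (insert v V) N t = (\<Sum>j=1..N. ?x ^ j * F (t - K v * j))"
      using A that Kv insert.hyps by (subst subst_sum_insert) (auto simp: F)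
    also have "\<dots> = F' t"
      unfolding F'_def
    proof (rule sum.mono_neutral_right)
      show "\<forall>j\<in>{1..N} - {1..t}. ?x ^ j * F (t - K v * j) = 0"
      proof
        fix j assume "j \<in> {1..N} - {1..t}"
        then have "t \<le> 1 * j" by auto
        also have "\<dots> \<le> K v * j" using Kv by (intro mult_right_mono) auto
        finally show "?x ^ j * F (t - K v * j) = 0" using F0 by simp
      qed
    qed (use that in auto)
    finally show ?thesis .
  qed
  show ?case
  proof (cases "K v = 1")
    case True
    have eqs: "{w \<in> insert v V. K w = 1} = insert v {w\<in>V. K w = 1}"
      "{w \<in> insert v V. K w > 1} = {w\<in>V. K w > 1}"
      using True by auto
    have d: "card {w \<in> insert v V. K w = 1} = ?d"
      unfolding eqs using insert.hyps by simp
    \<comment> \<open>The ratio is \<open>1 / m ^ 0 = 1\<close>, and \<open>i = t - j\<close> runs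
      through all values below \<open>t\<close>.\<close>
    have "F' t = (\<Sum>i<t. F i)" for t
      unfolding F'_def True
      by (rule sum.reindex_bij_witness[of _ "\<lambda>i. t - i" "\<lambda>j. t - j"]) auto
    then have "(\<lambda>t. F' t / real t ^ Suc ?d) \<longlonglongrightarrow> ?C / real (Suc ?d)"
      using partial_sums_power_asymptotics[OF lim] by simp
    then show ?thesis
      unfolding d eqs(2) using F' by (intro exI[of _ F']) (auto simp: mult_ac)
  next
    case False
    then have K1: "K v > 1" using Kv by simp
    have eqs: "{w \<in> insert v V. K w = 1} = {w\<in>V. K w = 1}"
      "{w \<in> insert v V. K w > 1} = insert v {w\<in>V. K w > 1}"
      using K1 by auto
    have m: "?m ^ (K v - 1) > 1" using A K1 by (intro one_less_power) auto
    have "0 < ?x"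
      using m by (intro divide_pos_pos) linarith+
    moreover have "?x < 1" using m by (subst divide_less_eq_1_pos) linarith+
    ultimately have "(\<lambda>t. F' t / real t ^ ?d) \<longlonglongrightarrow> ?C * (?x / (1 - ?x))"
      unfolding F'_def using Kv by (intro geometric_convolution_power_asymptotics lim F0)
    also have "?x / (1 - ?x) = 1 / (?m ^ (K v - 1) - 1)"
    proof -
      have "(1 / y) / (1 - 1 / y) = 1 / (y - 1)" if "y > 1" for y :: real
        using that by (simp add: field_simps)
      then show ?thesis using m by blast
    qed
    also have "?C * \<dots> = 1 / (\<Prod>w\<in>{w \<in> insert v V. K w > 1}. ?m ^ (K w - 1) - 1) / fact ?d"
      unfolding eqs using insert.hyps by (subst prod.insert) (auto simp: divide_simps)
    finally show ?thesis
      unfolding eqs(1) using F' by (intro exI[of _ F']) auto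
  qed
qed

section \<open>The mean as a weighted sum\<close>

text \<open>Universal property of the free monoid: a morphism is determined by its values on
  letters, and these can be prescribed freely. Removing \<open>[]\<close> from the values encodes
  nonerasing.\<close>

lemma bij_betw_nonerasing_morphisms:
  "bij_betw (\<lambda>\<phi>. \<lambda>u\<in>lists V. concat (map \<phi> u)) (V \<rightarrow>\<^sub>E lists A - {[]}) (nonerasing_morphisms V A)"
proof (rule bij_betw_byWitness[where f' = "\<lambda>h. \<lambda>x\<in>V. h [x]"])
  show "\<forall>\<phi>\<in>V \<rightarrow>\<^sub>E lists A - {[]}. (\<lambda>x\<in>V. (\<lambda>u\<in>lists V. concat (map \<phi> u)) [x]) = \<phi>"
  proof
    fix \<phi> assume \<phi>: "\<phi> \<in> V \<rightarrow>\<^sub>E lists A - {[]}"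
    show "(\<lambda>x\<in>V. (\<lambda>u\<in>lists V. concat (map \<phi> u)) [x]) = \<phi>"
      by (rule extensionalityI[of _ V]) (use \<phi> in \<open>auto simp: PiE_def\<close>)
  qed
  show "\<forall>h\<in>nonerasing_morphisms V A.
      (\<lambda>u\<in>lists V. concat (map (\<lambda>x\<in>V. h [x]) u)) = h"
  proof
    fix h assume h: "h \<in> nonerasing_morphisms V A"
    show "(\<lambda>u\<in>lists V. concat (map (\<lambda>x\<in>V. h [x]) u)) = h"
    proof (rule extensionalityI[of _ "lists V"])
      show "h \<in> extensional (lists V)" using nonerasing_morphism_PiE[OF h] by (auto simp: PiE_def)
      fix u assume u: "u \<in> lists V"
      have "map (\<lambda>x\<in>V. h [x]) u = map (\<lambda>x. h [x]) u" using u by auto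
      then show "(\<lambda>u\<in>lists V. concat (map (\<lambda>x\<in>V. h [x]) u)) u = h u"
        using u morphism_eq_concat[OF h u] by (simp only: restrict_apply' if_True)
    qed auto
  qed
  show "(\<lambda>\<phi>. \<lambda>u\<in>lists V. concat (map \<phi> u)) ` (V \<rightarrow>\<^sub>E lists A - {[]}) \<subseteq> nonerasing_morphisms V A"
  proof (rule image_subsetI)
    fix \<phi> assume \<phi>: "\<phi> \<in> V \<rightarrow>\<^sub>E lists A - {[]}"
    have "concat (map \<phi> u) \<in> lists A" if "u \<in> lists V" for u
      using that
    proof (induction u)
      case (Cons x u)
      then show ?case using PiE_mem[OF \<phi>, of x] by simp
    qed simp
    then show "(\<lambda>u\<in>lists V. concat (map \<phi> u)) \<in> nonerasing_morphisms V A"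
      using \<phi> PiE_mem[OF \<phi>] by (auto simp: nonerasing_morphisms_def)
  qed
  show "(\<lambda>h. \<lambda>x\<in>V. h [x]) ` nonerasing_morphisms V A \<subseteq> V \<rightarrow>\<^sub>E lists A - {[]}"
  proof (rule image_subsetI)
    fix h assume h: "h \<in> nonerasing_morphisms V A"
    show "(\<lambda>x\<in>V. h [x]) \<in> V \<rightarrow>\<^sub>E lists A - {[]}"
    proof (rule restrict_PiE_iff[THEN iffD2], intro ballI)
      fix x assume "x \<in> V"
      then show "h [x] \<in> lists A - {[]}"
        using h PiE_mem[OF nonerasing_morphism_PiE[OF h], of "[x]"]
        by (simp add: nonerasing_morphisms_def)
    qed
  qed
qed

lemma length_concat_map:
  "length (concat (map \<phi> p)) = image_length (count_list p) (set p) \<phi>"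
  using sum_list_map_eq_sum_count[of "length \<circ> \<phi>" p]
  by (simp add: image_length_def length_concat comp_def)

lemma length_le_image_length:
  assumes "finite V" "v \<in> V" "K v \<ge> 1"
  shows "length (\<phi> v) \<le> image_length K V \<phi>"
proof -
  have "1 * length (\<phi> v) \<le> K v * length (\<phi> v)" using assms by (intro mult_right_mono) auto
  also have "\<dots> \<le> image_length K V \<phi>"
    unfolding image_length_def using assms by (intro member_le_sum) auto
  finally show ?thesis by simp
qed

lemma factor_positions_empty:
  "length w < length u \<Longrightarrow> factor_positions u w = {}"
  by (auto simp: factor_positions_def)

lemma count_list_ge_1: "v \<in> set p \<Longrightarrow> count_list p v \<ge> 1"
  using count_list_0_iff[of p v] by (simp add: Suc_le_eq)

text \<open>Every variable occurs in \<open>p\<close>, so an image longer than \<open>N\<close>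
  makes the image of \<open>p\<close> longer than \<open>w\<close>, and no position remains. The
  cutoff is any bound on the length, so one \<open>N\<close> serves all words of length
  \<open>n\<close>.\<close>

lemma occurrences_eq_subst_sum:
  assumes A: "finite A" and N: "length w \<le> N"
  shows "occurrences A p w =
    (\<Sum>\<phi>\<in>set p \<rightarrow>\<^sub>E bounded_words A N. card (factor_positions (concat (map \<phi> p)) w))"
proof -
  let ?f = "\<lambda>\<phi>. card (factor_positions (concat (map \<phi> p)) w)"
  have "occurrences A p w = (\<Sum>\<^sub>\<infinity>\<phi>\<in>set p \<rightarrow>\<^sub>E lists A - {[]}. ?f \<phi>)"
    unfolding occurrences_def
    by (subst infsum_reindex_bij_betw[OF bij_betw_nonerasing_morphisms, symmetric])
       (simp add: in_lists_conv_set)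
  also have "\<dots> = (\<Sum>\<^sub>\<infinity>\<phi>\<in>set p \<rightarrow>\<^sub>E bounded_words A N. ?f \<phi>)"
  proof (rule infsum_cong_neutral)
    \<comment> \<open>This difference is empty, since bounded words are nonempty words over
      \<open>A\<close>.\<close>
    show "?f \<phi> = 0" if "\<phi> \<in> (set p \<rightarrow>\<^sub>E bounded_words A N) - (set p \<rightarrow>\<^sub>E lists A - {[]})" for \<phi>
      using that by (auto simp: PiE_def Pi_def bounded_words_def)
    show "?f \<phi> = 0" if "\<phi> \<in> (set p \<rightarrow>\<^sub>E lists A - {[]}) - (set p \<rightarrow>\<^sub>E bounded_words A N)" for \<phi>
    proof -
      from that obtain v where v: "v \<in> set p" "length (\<phi> v) > N"
        by (auto simp: PiE_def Pi_def bounded_words_def not_le)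
      have "length w < length (\<phi> v)" using v N by simp
      also have "\<dots> \<le> length (concat (map \<phi> p))"
        unfolding length_concat_map using v
        by (intro length_le_image_length count_list_ge_1) auto
      finally show ?thesis by (simp add: factor_positions_empty)
    qed
  qed auto
  also have "\<dots> = (\<Sum>\<phi>\<in>set p \<rightarrow>\<^sub>E bounded_words A N. ?f \<phi>)"
    by (intro infsum_finite finite_PiE finite_bounded_words A finite_set)
  finally show ?thesis .
qed

text \<open>With \<open>u\<close> fixed at position \<open>i\<close>, the word is uniquely a free
  prefix of length \<open>i\<close> and a free suffix, together \<open>n - length u\<close>
  letters.\<close>

lemma card_words_with_factor_at:
  assumes A: "finite A" and u: "u \<in> lists A" and i: "i + length u \<le> n"
  shows "card {w \<in> words A n. i \<in> factor_positions u w} = card A ^ (n - length u)"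
proof -
  let ?S = "words A i \<times> words A (n - length u - i)"
  have "{w \<in> words A n. i \<in> factor_positions u w} = (\<lambda>(x, y). x @ u @ y) ` ?S"
  proof (intro equalityI subsetI)
    fix w assume "w \<in> {w \<in> words A n. i \<in> factor_positions u w}"
    then obtain x y where w: "w = x @ u @ y" "length x = i" "w \<in> words A n"
      by (auto simp: factor_positions_def)
    then have "(x, y) \<in> ?S" by (auto simp: words_def)
    then show "w \<in> (\<lambda>(x, y). x @ u @ y) ` ?S" using w(1) by (intro image_eqI[of _ _ "(x, y)"]) auto
  qed (use u i in \<open>auto simp: words_def factor_positions_def\<close>)
  moreover have "inj_on (\<lambda>(x, y). x @ u @ y) ?S"
    by (auto simp: inj_on_def words_def)
  moreover have "i + (n - length u - i) = n - length u" using i by simp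
  ultimately show ?thesis
    using A by (simp add: card_image card_cartesian_product card_words flip: power_add)
qed

text \<open>Double counting of pairs of a word and a position. If \<open>u\<close> is too long, the
  first factor on the right truncates to 0.\<close>

lemma sum_card_factor_positions:
  assumes A: "finite A" and u: "u \<in> lists A"
  shows "(\<Sum>w\<in>words A n. card (factor_positions u w)) =
    (n + 1 - length u) * card A ^ (n - length u)"
proof (cases "length u \<le> n")
  case False
  then have "card (factor_positions u w) = 0" if "w \<in> words A n" for w
    using that by (subst factor_positions_empty) (auto simp: words_def)
  then show ?thesis using False by simp
next
  case True
  let ?I = "{..n - length u}"
  \<comment> \<open>A position range common to all words is what allows the two sums to be
    exchanged.\<close>
  have sub: "factor_positions u w = {i \<in> ?I. i \<in> factor_positions u w}" if "w \<in> words A n" for w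
    using that by (auto simp: factor_positions_def words_def)
  have "(\<Sum>w\<in>words A n. card (factor_positions u w))
      = (\<Sum>w\<in>words A n. \<Sum>i\<in>{i \<in> ?I. i \<in> factor_positions u w}. 1)"
    using sub by (intro sum.cong) auto
  also have "\<dots> = (\<Sum>i\<in>?I. \<Sum>w\<in>{w \<in> words A n. i \<in> factor_positions u w}. 1)"
    by (rule sum.swap_restrict) (auto intro: finite_words A)
  also have "\<dots> = (\<Sum>i\<in>?I. card A ^ (n - length u))"
    using True by (intro sum.cong) (simp_all add: card_words_with_factor_at[OF A u])
  finally show ?thesis using True by (simp add: Suc_diff_le)
qed

text \<open>Linearity of the mean over substitutions. An image of length \<open>L\<close> has
  \<open>n + 1 - L\<close> possible positions, hence the argument \<open>n + 1\<close>, and fits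
  each of them with probability \<open>1 / m ^ L\<close>.\<close>

lemma mean_occurrences_eq_subst_sum:
  assumes A: "finite A" "card A \<ge> 1" and N: "n \<le> N"
  shows "mean_occurrences A p n = subst_sum A (count_list p) (set p) N (n + 1)"
proof -
  let ?W = "set p \<rightarrow>\<^sub>E bounded_words A N" and ?m = "real (card A)"
  let ?L = "image_length (count_list p) (set p)"
  have "(\<Sum>w\<in>words A n. occurrences A p w)
      = (\<Sum>w\<in>words A n. \<Sum>\<phi>\<in>?W. card (factor_positions (concat (map \<phi> p)) w))"
    using A N by (intro sum.cong occurrences_eq_subst_sum refl) (auto simp: words_def)
  also have "\<dots> = (\<Sum>\<phi>\<in>?W. \<Sum>w\<in>words A n. card (factor_positions (concat (map \<phi> p)) w))"
    by (rule sum.swap)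
  also have "\<dots> = (\<Sum>\<phi>\<in>?W. (n + 1 - ?L \<phi>) * card A ^ (n - ?L \<phi>))"
  proof (intro sum.cong refl)
    fix \<phi> assume "\<phi> \<in> ?W"
    then have "set (\<phi> v) \<subseteq> A" if "v \<in> set p" for v
      using PiE_mem[of \<phi> "set p" _ v] that by (auto simp: bounded_words_def)
    then have "concat (map \<phi> p) \<in> lists A" by (fastforce simp: in_lists_conv_set)
    then show "(\<Sum>w\<in>words A n. card (factor_positions (concat (map \<phi> p)) w)) =
        (n + 1 - ?L \<phi>) * card A ^ (n - ?L \<phi>)"
      by (simp only: sum_card_factor_positions[OF A(1)] length_concat_map)
  qed
  finally have "(\<Sum>w\<in>words A n. real (occurrences A p w)) / ?m ^ n =
      (\<Sum>\<phi>\<in>?W. real (n + 1 - ?L \<phi>) * ?m ^ (n - ?L \<phi>)) / ?m ^ n"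
    by (simp flip: of_nat_sum of_nat_power of_nat_mult)
  also have "\<dots> = (\<Sum>\<phi>\<in>?W. real (n + 1 - ?L \<phi>) / ?m ^ ?L \<phi>)"
    unfolding sum_divide_distrib
  proof (intro sum.cong refl)
    fix \<phi>
    show "real (n + 1 - ?L \<phi>) * ?m ^ (n - ?L \<phi>) / ?m ^ n = real (n + 1 - ?L \<phi>) / ?m ^ ?L \<phi>"
    \<comment> \<open>Otherwise the truncated factor \<open>n + 1 - ?L \<phi>\<close> is 0 and both
      sides vanish.\<close>
    proof (cases "?L \<phi> \<le> n")
      case True
      then have "?m ^ n = ?m ^ (n - ?L \<phi>) * ?m ^ ?L \<phi>" by (simp flip: power_add)
      moreover have "?m > 0" using A by linarith
      ultimately show ?thesis by (simp del: of_nat_0_less_iff)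
    qed simp
  qed
  finally show ?thesis
    using A by (simp add: mean_occurrences_def subst_sum_def card_words)
qed

section \<open>Asymptotics of the mean in the indexed variables\<close>

theorem theorem5:
  fixes A :: "'a set" and p :: "'v list"
    and m r s :: nat and var :: "nat \<Rightarrow> 'v" and k :: "nat \<Rightarrow> nat"
  assumes "m \<ge> 2" and "finite A" and "card A = m"
    and "p \<noteq> []" and "r \<ge> 1" and "s \<le> r"
    and "bij_betw var {1..r} (set p)"
    and "\<And>j. j \<in> {1..r} \<Longrightarrow> k j = count_list p (var j)"
    and "\<And>j. j \<in> {1..s} \<Longrightarrow> k j = 1"
    and "\<And>j. j \<in> {s+1..r} \<Longrightarrow> 1 < k j"
    and "mono_on {s+1..r} k"
  shows "(\<lambda>n. mean_occurrences A p n) \<sim>[at_top]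
           (\<lambda>n. 1 / (\<Prod>j=s+1..r. real m ^ (k j - 1) - 1) * (real n ^ (s+1) / fact (s+1)))"
proof -
  let ?K = "count_list p"
  have inj: "inj_on var {1..r}" and im: "var ` {1..r} = set p"
    using assms(7) by (auto simp: bij_betw_def)
  \<comment> \<open>Within \<open>{1..r}\<close> the index \<open>s\<close> separates
    \<open>k j = 1\<close> from \<open>k j > 1\<close>, so the two classes of variables are the
    images under \<open>var\<close> of intervals.\<close>
  have le1: "j \<le> s" if "j \<in> {1..r}" "k j = 1" for j
    using assms(10)[of j] that by fastforce
  have gt1: "s + 1 \<le> j" if "j \<in> {1..r}" "k j > 1" for j
    using assms(9)[of j] that by fastforce
  have "{j \<in> {1..r}. k j = 1} = {1..s}"
    using le1 assms(6,9) by auto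
  moreover have "{v \<in> set p. ?K v = 1} = var ` {j \<in> {1..r}. k j = 1}"
    unfolding im[symmetric] by (auto simp: assms(8))
  ultimately have ones: "{v \<in> set p. ?K v = 1} = var ` {1..s}"
    by simp
  have "{j \<in> {1..r}. k j > 1} = {s+1..r}"
    using gt1 assms(10) by auto
  moreover have "{v \<in> set p. ?K v > 1} = var ` {j \<in> {1..r}. k j > 1}"
    unfolding im[symmetric] by (auto simp: assms(8))
  ultimately have bigs: "{v \<in> set p. ?K v > 1} = var ` {s+1..r}"
    by simp
  have card_ones: "card {v \<in> set p. ?K v = 1} = s"
    unfolding ones using inj assms(6) by (subst card_image) (auto intro: inj_on_subset)
  have "(\<Prod>v\<in>{v \<in> set p. ?K v > 1}. real m ^ (?K v - 1) - 1)
      = (\<Prod>j=s+1..r. real m ^ (?K (var j) - 1) - 1)"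
    unfolding bigs using inj by (subst prod.reindex) (auto intro: inj_on_subset)
  also have "\<dots> = (\<Prod>j=s+1..r. real m ^ (k j - 1) - 1)"
    using assms(8) by (intro prod.cong) auto
  finally have prod_eq: "(\<Prod>v\<in>{v \<in> set p. ?K v > 1}. real m ^ (?K v - 1) - 1)
      = (\<Prod>j=s+1..r. real m ^ (k j - 1) - 1)" .
  let ?P = "\<Prod>j=s+1..r. real m ^ (k j - 1) - 1"
  have P: "?P > 0"
  proof (rule prod_pos)
    fix j assume "j \<in> {s+1..r}"
    then have "real m ^ (k j - 1) > 1"
      using assms(1) assms(10)[of j] by (intro one_less_power) auto
    then show "0 < real m ^ (k j - 1) - 1" by simp
  qed
  have "\<exists>F. (\<forall>N t. t \<le> N \<longrightarrow> subst_sum A ?K (set p) N t = F t) \<and>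
     (\<lambda>t. F t / real t ^ Suc s) \<longlonglongrightarrow> 1 / ?P / fact (Suc s)"
    using subst_sum_asymptotics[of "set p" A ?K] assms(1-3) count_list_ge_1[of _ p]
    by (simp only: card_ones prod_eq assms(3)) auto
  then obtain F where F: "\<And>N t. t \<le> N \<Longrightarrow> subst_sum A ?K (set p) N t = F t"
    and lim: "(\<lambda>t. F t / real t ^ Suc s) \<longlonglongrightarrow> 1 / ?P / fact (Suc s)"
    by blast
  \<comment> \<open>The cutoff \<open>n + 1\<close> bounds both the word length \<open>n\<close> and
    the argument \<open>t = n + 1\<close>.\<close>
  have mean: "mean_occurrences A p n = F (Suc n)" for n
    using mean_occurrences_eq_subst_sum[of A n "n + 1" p] assms(1-3) F by simp
  \<comment> \<open>The factor tending to 1 replaces \<open>(n + 1) ^ (s + 1)\<close> by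
    \<open>n ^ (s + 1)\<close> in the denominator.\<close>
  have "(\<lambda>n. F (Suc n) / real (Suc n) ^ Suc s * (1 + 1 / real n) ^ Suc s)
      \<longlonglongrightarrow> 1 / ?P / fact (Suc s) * (1 + 0) ^ Suc s"
    by (intro tendsto_intros LIMSEQ_Suc[OF lim] lim_1_over_n)
  moreover have "eventually (\<lambda>n. F (Suc n) / real (Suc n) ^ Suc s * (1 + 1 / real n) ^ Suc s
      = mean_occurrences A p n / real n ^ (s + 1)) sequentially"
    using eventually_gt_at_top[of 0]
  proof eventually_elim
    case (elim n)
    have "1 + 1 / real n = real (Suc n) / real n" using elim by (simp add: field_simps)
    then have "(1 + 1 / real n) ^ Suc s = real (Suc n) ^ Suc s / real n ^ Suc s"
      by (simp only: power_divide)
    then show ?case unfolding mean by (simp del: power_Suc of_nat_Suc)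
  qed
  ultimately have "(\<lambda>n. mean_occurrences A p n / real n ^ (s + 1)) \<longlonglongrightarrow>
      1 / ?P / fact (Suc s) * (1 + 0) ^ Suc s"
    by (rule Lim_transform_eventually)
  then have "(\<lambda>n. mean_occurrences A p n / real n ^ (s + 1)) \<longlonglongrightarrow> 1 / ?P / fact (s + 1)"
    by simp
  \<comment> \<open>A nonzero limit is what turns convergence of the ratio into asymptotic
    equivalence.\<close>
  moreover have "1 / ?P / fact (s + 1) > 0"
    by (intro divide_pos_pos P fact_gt_zero zero_less_one)
  ultimately have "(\<lambda>n. mean_occurrences A p n) \<sim>[at_top] (\<lambda>n. 1 / ?P / fact (s + 1) * real n ^ (s + 1))"
    by (intro asymp_equivI'_const) (assumption, rule less_imp_neq[symmetric])
  then show ?thesis by simp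
qed

end
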